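(* Given a reduced $F$-finite ring $R$ (of prime characteristic $p>0$) with normalization $R^N$, the conductor ideal $\operatorname{Ann}_R(R^N/R)=\{x\in R\mid xR^N\subseteq R\}$ of $R$ in $R^N$ is uniformly $F$-compatible.
   Context: Rings are commutative, noetherian and excellent. $R^N$ is the integral closure of $R$ in its total ring of fractions. $F^e_*R$ is $R$ viewed as an $R$-module via the $e$-iterated Frobenius; $R$ is $F$-finite if $F_*R$ is a finite $R$-module. An ideal $I\subseteq R$ is uniformly $F$-compatible if for every $e>0$ and every $R$-linear map $\phi:F^e_*R\to R$ one has $\phi(F^e_*I)\subseteq I$. *)

theory Defs
  imports "HOL-Computational_Algebra.Computational_Algebra"
begin

text \<open>
  A ring \<open>R\<close> is a type \<open>'a :: comm_ring_1\<close>. This excludes the zero ring, which has no prime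
  characteristic.
\<close>

section \<open>Ideals, noetherian rings and reduced rings\<close>

lemma module_mult: "module ((*) :: 'a::comm_ring_1 \<Rightarrow> 'a \<Rightarrow> 'a)"
  by standard (simp_all add: algebra_simps)

definition is_ideal :: "'a::comm_ring_1 set \<Rightarrow> bool" where
  "is_ideal I \<longleftrightarrow> module.subspace (*) I"

definition noetherian :: "'a::comm_ring_1 itself \<Rightarrow> bool" where
  "noetherian _ \<longleftrightarrow> (\<forall>I :: 'a set. is_ideal I \<longrightarrow> (\<exists>S. finite S \<and> I = module.span (*) S))"

definition reduced :: "'a::comm_ring_1 itself \<Rightarrow> bool" where
  "reduced _ \<longleftrightarrow> (\<forall>(x::'a) n. x ^ n = 0 \<longrightarrow> x = 0)"

section \<open>The total ring of fractions\<close>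

definition nonzerodivisor :: "'a::comm_ring_1 \<Rightarrow> bool" where
  "nonzerodivisor b \<longleftrightarrow> (\<forall>x. b * x = 0 \<longrightarrow> x = 0)"

lemma nonzerodivisor_1 [simp]: "nonzerodivisor 1"
  by (simp add: nonzerodivisor_def)

lemma nonzerodivisor_mult [simp]:
  "nonzerodivisor a \<Longrightarrow> nonzerodivisor b \<Longrightarrow> nonzerodivisor (a * b)"
  unfolding nonzerodivisor_def by (metis mult.assoc)

lemma nonzerodivisor_cancel: "nonzerodivisor b \<Longrightarrow> b * x = b * y \<longleftrightarrow> x = y"
  unfolding nonzerodivisor_def by (metis eq_iff_diff_eq_0 right_diff_distrib)

definition tfrac_rel :: "'a::comm_ring_1 \<times> 'a \<Rightarrow> 'a \<times> 'a \<Rightarrow> bool" where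
  "tfrac_rel q r \<longleftrightarrow>
     nonzerodivisor (snd q) \<and> nonzerodivisor (snd r) \<and> fst q * snd r = fst r * snd q"

lemma part_equivp_tfrac_rel: "part_equivp (tfrac_rel :: 'a::comm_ring_1 \<times> 'a \<Rightarrow> _)"
proof (rule part_equivpI)
  show "\<exists>x :: 'a \<times> 'a. tfrac_rel x x"
    by (rule exI[of _ "(0, 1)"]) (simp add: tfrac_rel_def)
  show "symp (tfrac_rel :: 'a \<times> 'a \<Rightarrow> _)"
    by (simp add: symp_def tfrac_rel_def)
  show "transp (tfrac_rel :: 'a \<times> 'a \<Rightarrow> _)"
  proof (rule transpI, unfold split_paired_all)
    fix a b a' b' a'' b'' :: 'a
    assume A: "tfrac_rel (a, b) (a', b')" and B: "tfrac_rel (a', b') (a'', b'')"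
    have "b' * (a * b'') = b'' * (a * b')" by (simp add: ac_simps)
    also from A have "a * b' = a' * b" by (simp add: tfrac_rel_def)
    also have "b'' * (a' * b) = b * (a' * b'')" by (simp add: ac_simps)
    also from B have "a' * b'' = a'' * b'" by (simp add: tfrac_rel_def)
    also have "b * (a'' * b') = b' * (a'' * b)" by (simp add: ac_simps)
    finally have "a * b'' = a'' * b"
      using A by (simp add: tfrac_rel_def nonzerodivisor_cancel)
    with A B show "tfrac_rel (a, b) (a'', b'')" by (simp add: tfrac_rel_def)
  qed
qed

quotient_type (overloaded) 'a tfrac = "'a::comm_ring_1 \<times> 'a" / partial: tfrac_rel
  by (rule part_equivp_tfrac_rel)

text \<open>Only meaningful when the denominator is not a zero divisor; the other value is a dummy.\<close>

lift_definition TFrac :: "'a::comm_ring_1 \<Rightarrow> 'a \<Rightarrow> 'a tfrac"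
  is "\<lambda>a b. if nonzerodivisor b then (a, b) else (0, 1)"
  by (simp add: tfrac_rel_def)

lemma TFrac_cases [cases type: tfrac]:
  obtains (TFrac) a b where "q = TFrac a b" "nonzerodivisor b"
  by transfer (auto simp: tfrac_rel_def)

lemma eq_TFrac:
  "nonzerodivisor b \<Longrightarrow> nonzerodivisor d \<Longrightarrow> TFrac a b = TFrac c d \<longleftrightarrow> a * d = c * b"
  by transfer (simp add: tfrac_rel_def)

instantiation tfrac :: (comm_ring_1) comm_ring_1
begin

lift_definition zero_tfrac :: "'a tfrac" is "(0, 1)" by (simp add: tfrac_rel_def)

lift_definition one_tfrac :: "'a tfrac" is "(1, 1)" by (simp add: tfrac_rel_def)

lift_definition plus_tfrac :: "'a tfrac \<Rightarrow> 'a tfrac \<Rightarrow> 'a tfrac"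
  is "\<lambda>q r. (fst q * snd r + fst r * snd q, snd q * snd r)"
proof -
  fix q q' r r' :: "'a \<times> 'a"
  assume A: "tfrac_rel q q'" and B: "tfrac_rel r r'"
  have "(fst q * snd r + fst r * snd q) * (snd q' * snd r') =
      (fst q * snd q') * (snd r * snd r') + (fst r * snd r') * (snd q * snd q')"
    by (simp add: algebra_simps)
  also have "fst q * snd q' = fst q' * snd q" using A by (simp add: tfrac_rel_def)
  also have "fst r * snd r' = fst r' * snd r" using B by (simp add: tfrac_rel_def)
  finally have "(fst q * snd r + fst r * snd q) * (snd q' * snd r') =
      (fst q' * snd r' + fst r' * snd q') * (snd q * snd r)"
    by (simp add: algebra_simps)
  then show "tfrac_rel (fst q * snd r + fst r * snd q, snd q * snd r)
      (fst q' * snd r' + fst r' * snd q', snd q' * snd r')"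
    using A B unfolding tfrac_rel_def by simp
qed

lift_definition uminus_tfrac :: "'a tfrac \<Rightarrow> 'a tfrac" is "\<lambda>q. (- fst q, snd q)"
  by (simp add: tfrac_rel_def)

definition minus_tfrac :: "'a tfrac \<Rightarrow> 'a tfrac \<Rightarrow> 'a tfrac" where
  "minus_tfrac q r = q + - r"

lift_definition times_tfrac :: "'a tfrac \<Rightarrow> 'a tfrac \<Rightarrow> 'a tfrac"
  is "\<lambda>q r. (fst q * fst r, snd q * snd r)"
proof -
  fix q q' r r' :: "'a \<times> 'a"
  assume A: "tfrac_rel q q'" and B: "tfrac_rel r r'"
  have "(fst q * fst r) * (snd q' * snd r') = (fst q * snd q') * (fst r * snd r')"
    by (simp add: algebra_simps)
  also have "fst q * snd q' = fst q' * snd q" using A by (simp add: tfrac_rel_def)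
  also have "fst r * snd r' = fst r' * snd r" using B by (simp add: tfrac_rel_def)
  finally have "(fst q * fst r) * (snd q' * snd r') = (fst q' * fst r') * (snd q * snd r)"
    by (simp add: ac_simps)
  then show "tfrac_rel (fst q * fst r, snd q * snd r) (fst q' * fst r', snd q' * snd r')"
    using A B unfolding tfrac_rel_def by simp
qed

lemma zero_TFrac: "0 = TFrac 0 1"
  by transfer (simp add: tfrac_rel_def)

lemma one_TFrac: "1 = TFrac 1 1"
  by transfer (simp add: tfrac_rel_def)

lemma add_TFrac [simp]:
  "nonzerodivisor b \<Longrightarrow> nonzerodivisor d \<Longrightarrow> TFrac a b + TFrac c d = TFrac (a * d + c * b) (b * d)"
  by transfer (simp add: tfrac_rel_def)

lemma minus_TFrac [simp]: "nonzerodivisor b \<Longrightarrow> - TFrac a b = TFrac (- a) b"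
  by transfer (simp add: tfrac_rel_def)

lemma mult_TFrac [simp]:
  "nonzerodivisor b \<Longrightarrow> nonzerodivisor d \<Longrightarrow> TFrac a b * TFrac c d = TFrac (a * c) (b * d)"
  by transfer (simp add: tfrac_rel_def)

instance
proof
  fix q r s :: "'a tfrac"
  show "(q * r) * s = q * (r * s)"
    by (cases q, cases r, cases s) (simp add: eq_TFrac algebra_simps)
  show "q * r = r * q"
    by (cases q, cases r) (simp add: eq_TFrac algebra_simps)
  show "1 * q = q"
    by (cases q) (simp add: one_TFrac eq_TFrac)
  show "(q + r) + s = q + (r + s)"
    by (cases q, cases r, cases s) (simp add: eq_TFrac algebra_simps)
  show "q + r = r + q"
    by (cases q, cases r) (simp add: eq_TFrac algebra_simps)
  show "0 + q = q"
    by (cases q) (simp add: zero_TFrac eq_TFrac)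
  show "- q + q = 0"
    by (cases q) (simp add: zero_TFrac eq_TFrac)
  show "q - r = q + - r"
    by (simp add: minus_tfrac_def)
  show "(q + r) * s = q * s + r * s"
    by (cases q, cases r, cases s) (simp add: eq_TFrac algebra_simps)
  show "(0::'a tfrac) \<noteq> 1"
    by (simp add: zero_TFrac one_TFrac eq_TFrac)
qed

end

definition to_tfrac :: "'a::comm_ring_1 \<Rightarrow> 'a tfrac" where
  "to_tfrac a = TFrac a 1"

lemma to_tfrac_0 [simp]: "to_tfrac 0 = 0"
  and to_tfrac_1 [simp]: "to_tfrac 1 = 1"
  and to_tfrac_add: "to_tfrac (a + b) = to_tfrac a + to_tfrac b"
  and to_tfrac_mult: "to_tfrac (a * b) = to_tfrac a * to_tfrac b"
  by (simp_all add: to_tfrac_def zero_TFrac one_TFrac)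

lemma inj_to_tfrac: "inj to_tfrac"
  by (rule injI) (simp add: to_tfrac_def eq_TFrac)

lemma to_tfrac_unit: "nonzerodivisor b \<Longrightarrow> to_tfrac b * TFrac 1 b = 1"
  by (simp add: to_tfrac_def one_TFrac eq_TFrac)

lemma TFrac_conv_to_tfrac: "nonzerodivisor b \<Longrightarrow> TFrac a b = to_tfrac a * TFrac 1 b"
  by (simp add: to_tfrac_def)

section \<open>Normalization and conductor\<close>

definition integral_over_base :: "'a::comm_ring_1 tfrac \<Rightarrow> bool" where
  "integral_over_base z \<longleftrightarrow> (\<exists>f :: 'a poly. lead_coeff f = 1 \<and> poly (map_poly to_tfrac f) z = 0)"

definition normalization :: "'a::comm_ring_1 tfrac set" where
  "normalization = {z. integral_over_base z}"

definition conductor :: "'a::comm_ring_1 set" where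
  "conductor = {x. (*) (to_tfrac x) ` normalization \<subseteq> range to_tfrac}"

section \<open>Frobenius and uniform F-compatibility\<close>

text \<open>
  The module \<open>F\<^sup>e\<^sub>*R\<close> has the underlying additive group of \<open>R\<close>, with the scalar action restricted
  along the \<open>e\<close>-fold Frobenius.
\<close>

definition frob_scale :: "nat \<Rightarrow> 'a::comm_ring_1 \<Rightarrow> 'a \<Rightarrow> 'a" where
  "frob_scale e r x = r ^ (CHAR('a) ^ e) * x"

lemma module_frob_scale:
  assumes "prime CHAR('a::comm_ring_1)"
  shows "module (frob_scale e :: 'a \<Rightarrow> 'a \<Rightarrow> 'a)"
proof
  fix a b x y :: 'a
  show "frob_scale e a (x + y) = frob_scale e a x + frob_scale e a y"
    by (simp add: frob_scale_def distrib_left)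
  show "frob_scale e (a + b) x = frob_scale e a x + frob_scale e b x"
    using assms by (simp add: frob_scale_def freshmans_dream' distrib_right)
  show "frob_scale e a (frob_scale e b x) = frob_scale e (a * b) x"
    by (simp add: frob_scale_def power_mult_distrib mult.assoc)
  show "frob_scale e 1 x = x"
    by (simp add: frob_scale_def)
qed

text \<open>
  A noetherian F-finite ring is excellent by a theorem of Kunz, so excellence does not have to be
  required separately for such rings.
\<close>

definition F_finite :: "'a::comm_ring_1 itself \<Rightarrow> bool" where
  "F_finite _ \<longleftrightarrow> (\<exists>S :: 'a set. finite S \<and> module.span (frob_scale 1) S = UNIV)"

definition uniformly_F_compatible :: "'a::comm_ring_1 set \<Rightarrow> bool" where
  "uniformly_F_compatible I \<longleftrightarrow> is_ideal I \<and>
     (\<forall>e>0. \<forall>\<phi> :: 'a \<Rightarrow> 'a. module_hom (frob_scale e) (*) \<phi> \<longrightarrow> \<phi> ` I \<subseteq> I)"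

end

theory Submission
  imports Defs
begin

text \<open>
  The usual argument extends \<open>\<phi> : F\<^sup>e\<^sub>*R \<rightarrow> R\<close> to the total ring of fractions and restricts the extension
  to the normalization; here both steps are condensed into one computation in \<open>R\<close>. Put
  \<open>q = p ^ e\<close>, let \<open>x\<close> lie in the conductor and let \<open>z = a / b\<close> be integral over \<open>R\<close>. Then \<open>z ^ q\<close> is
  integral as well, so \<open>x z ^ q\<close> is an element \<open>y\<close> of \<open>R\<close>, which means \<open>a ^ q x = b ^ q y\<close>. Applying
  \<open>\<phi>\<close> and pulling the \<open>q\<close>-th powers out gives \<open>a \<phi>(x) = b \<phi>(y)\<close>, that is, \<open>\<phi>(x) z = \<phi>(y) \<in> R\<close>.

  That \<open>z ^ q\<close> is integral follows from the Frobenius of the total ring of fractions: it carries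
  a monic equation for \<open>z\<close> to a monic equation for \<open>z ^ q\<close> whose coefficients are the \<open>q\<close>-th
  powers of the original ones.
\<close>

lemma to_tfrac_of_nat: "to_tfrac (of_nat n) = of_nat n"
  by (induction n) (simp_all add: to_tfrac_add)

lemma to_tfrac_power: "to_tfrac (a ^ n) = to_tfrac a ^ n"
  by (induction n) (simp_all add: to_tfrac_mult)

lemma to_tfrac_eq_0_iff [simp]: "to_tfrac a = 0 \<longleftrightarrow> a = 0"
  using inj_to_tfrac[THEN inj_eq, of a 0] by simp

lemma CHAR_tfrac [simp]: "CHAR('a::comm_ring_1 tfrac) = CHAR('a)"
proof (rule CHAR_eqI)
  show "of_nat CHAR('a) = (0 :: 'a tfrac)"
    by (simp flip: to_tfrac_of_nat)
  show "CHAR('a) dvd n" if "of_nat n = (0 :: 'a tfrac)" for n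
    using that by (simp add: of_nat_eq_0_iff_char_dvd flip: to_tfrac_of_nat)
qed

text \<open>
  In characteristic \<open>p\<close> the map \<open>u \<mapsto> u ^ q\<close> is a ring endomorphism of the total ring of fractions,
  so it can be moved through the evaluation of a polynomial. Its effect on the coefficients can be
  computed in the base ring, which is what keeps integral equations over that ring.
\<close>

lemma poly_frobenius:
  fixes f :: "'a::comm_ring_1 poly"
  assumes "prime CHAR('a)" and q: "q = CHAR('a) ^ e"
  shows "poly (map_poly to_tfrac (map_poly (\<lambda>c. c ^ q) f)) (z ^ q) =
    poly (map_poly to_tfrac f) z ^ q"
proof -
  have "q > 0"
    using assms by (simp add: prime_gt_0_nat)
  have add: "(u + v) ^ q = u ^ q + v ^ q" for u v :: "'a tfrac"
    using assms freshmans_dream'[of q e u v] by simp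
  show ?thesis
    using \<open>q > 0\<close>
    by (induction f) (simp_all add: zero_power map_poly_pCons add to_tfrac_power power_mult_distrib)
qed

lemma normalization_frobenius_power:
  fixes z :: "'a::comm_ring_1 tfrac"
  assumes "prime CHAR('a)" and "z \<in> normalization"
  shows "z ^ (CHAR('a) ^ e) \<in> normalization"
proof -
  define q where "q = CHAR('a) ^ e"
  have "q > 0"
    using assms(1) by (simp add: q_def prime_gt_0_nat)
  obtain f :: "'a poly" where f: "lead_coeff f = 1" "poly (map_poly to_tfrac f) z = 0"
    using assms(2) by (auto simp: normalization_def integral_over_base_def)
  define g where "g = map_poly (\<lambda>c. c ^ q) f"
  have "lead_coeff g = 1"
    using f(1) \<open>q > 0\<close> by (simp add: g_def lead_coeff_map_poly_nz zero_power)
  moreover have "poly (map_poly to_tfrac g) (z ^ q) = 0"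
    using poly_frobenius[OF assms(1) q_def, of f z] f(2) \<open>q > 0\<close> by (simp add: g_def zero_power)
  ultimately show ?thesis
    by (auto simp: normalization_def integral_over_base_def q_def)
qed

lemma mem_conductor_iff:
  "x \<in> conductor \<longleftrightarrow> (\<forall>z\<in>normalization. to_tfrac x * z \<in> range to_tfrac)"
  by (auto simp: conductor_def)

lemma is_ideal_conductor: "is_ideal (conductor :: 'a::comm_ring_1 set)"
proof -
  interpret module "(*) :: 'a \<Rightarrow> 'a \<Rightarrow> 'a"
    by (rule module_mult)
  show ?thesis
    unfolding is_ideal_def
  proof (rule subspaceI)
    show "(0 :: 'a) \<in> conductor"
      by (auto simp: mem_conductor_iff intro: range_eqI[of _ _ 0])
  next
    fix x y :: 'a
    assume "x \<in> conductor" "y \<in> conductor"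
    then show "x + y \<in> conductor"
      unfolding mem_conductor_iff
      by (metis (no_types, lifting) distrib_right imageE rangeI to_tfrac_add)
  next
    fix c x :: 'a
    assume "x \<in> conductor"
    then show "c * x \<in> conductor"
      unfolding mem_conductor_iff
      by (metis (no_types, lifting) imageE mult.assoc rangeI to_tfrac_mult)
  qed
qed

lemma conductor_frobenius_hom:
  fixes \<phi> :: "'a::comm_ring_1 \<Rightarrow> 'a"
  assumes p: "prime CHAR('a)" and \<phi>: "module_hom (frob_scale e) (*) \<phi>"
    and x: "x \<in> conductor"
  shows "\<phi> x \<in> conductor"
  unfolding mem_conductor_iff
proof
  fix z :: "'a tfrac"
  assume z: "z \<in> normalization"
  define q where "q = CHAR('a) ^ e"
  have scale: "\<phi> (r ^ q * s) = r * \<phi> s" for r s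
    using module_hom.scale[OF \<phi>, of r s] by (simp add: frob_scale_def q_def)
  obtain a b where ab: "z = TFrac a b" "nonzerodivisor b"
    by (cases z)
  have bz: "to_tfrac b * z = to_tfrac a"
    using ab by (simp add: to_tfrac_def eq_TFrac)
  have "z ^ q \<in> normalization"
    unfolding q_def by (rule normalization_frobenius_power[OF p z])
  then obtain y where y: "to_tfrac x * z ^ q = to_tfrac y"
    using x by (auto simp: mem_conductor_iff)
  have "to_tfrac (b ^ q * y) = (to_tfrac b * z) ^ q * to_tfrac x"
    by (simp add: to_tfrac_mult to_tfrac_power power_mult_distrib flip: y)
  also have "\<dots> = to_tfrac (a ^ q * x)"
    by (simp add: bz to_tfrac_mult to_tfrac_power)
  finally have "a ^ q * x = b ^ q * y"
    using inj_to_tfrac by (metis injD)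
  then have "a * \<phi> x = b * \<phi> y"
    by (metis scale)
  then have "to_tfrac (\<phi> x) * z = to_tfrac (\<phi> y)"
    using ab by (simp add: to_tfrac_def eq_TFrac mult.commute)
  then show "to_tfrac (\<phi> x) * z \<in> range to_tfrac"
    by simp
qed

theorem proposition7p10:
  assumes "prime CHAR('a::comm_ring_1)"
    and "noetherian TYPE('a)"
    and "reduced TYPE('a)"
    and "F_finite TYPE('a)"
  shows "uniformly_F_compatible (conductor :: 'a set)"
  using is_ideal_conductor conductor_frobenius_hom[OF assms(1)]
  by (auto simp: uniformly_F_compatible_def)

end
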